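(* Let $k,n\ge 1$ and $r>s\ge 0$ be integers. Let $c_{k,n,o}^{r,s}$ (respectively $c_{k,n,e}^{r,s}$) be the number of odd (respectively even) compositions of $n+k-1$ all of whose parts are no less than $k$ and congruent to $k+s$ modulo $r$, and let $b_{k,n}^{r,s}:=c_{k,n,o}^{r,s}-c_{k,n,e}^{r,s}$. Then \[ b_{k,n}^{r,s}=\sum_{ri+j(k+s)=n-1-s}(-1)^j\binom{i+j}{i}, \] where the sum is over all pairs $(i,j)$ of nonnegative integers satisfying $ri+j(k+s)=n-1-s$ (an empty sum being $0$).
   Context: A composition of a nonnegative integer $N$ is a finite sequence $\alpha=(\alpha_1,\ldots,\alpha_\ell)$ of positive integers with $\alpha_1+\cdots+\alpha_\ell=N$; the $\alpha_i$ are its parts and $\ell$ is its length. A composition is called even (respectively odd) if its length $\ell$ is even (respectively odd). *)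

theory Defs
  imports Main "HOL-Number_Theory.Cong"
begin

definition is_composition :: "nat \<Rightarrow> nat list \<Rightarrow> bool" where
  "is_composition N \<alpha> \<longleftrightarrow> (\<forall>p\<in>set \<alpha>. 0 < p) \<and> sum_list \<alpha> = N"

text \<open>The subtraction below is on natural numbers; it does not truncate as long as
  \<open>n + k \<ge> 1\<close>.\<close>

definition restricted_compositions :: "nat \<Rightarrow> nat \<Rightarrow> nat \<Rightarrow> nat \<Rightarrow> nat list set" where
  "restricted_compositions k n r s =
     {\<alpha>. is_composition (n + k - 1) \<alpha> \<and> (\<forall>p\<in>set \<alpha>. k \<le> p \<and> [p = k + s] (mod r))}"

definition c_odd :: "nat \<Rightarrow> nat \<Rightarrow> nat \<Rightarrow> nat \<Rightarrow> nat" where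
  "c_odd k n r s = card {\<alpha> \<in> restricted_compositions k n r s. odd (length \<alpha>)}"

definition c_even :: "nat \<Rightarrow> nat \<Rightarrow> nat \<Rightarrow> nat \<Rightarrow> nat" where
  "c_even k n r s = card {\<alpha> \<in> restricted_compositions k n r s. even (length \<alpha>)}"

definition b_diff :: "nat \<Rightarrow> nat \<Rightarrow> nat \<Rightarrow> nat \<Rightarrow> int" where
  "b_diff k n r s = int (c_odd k n r s) - int (c_even k n r s)"

text \<open>Since \<open>card\<close> and \<open>sum\<close> are \<open>0\<close> on infinite sets, we record that the sets counted and
  summed over are finite.\<close>

lemma finite_restricted_compositions: "finite (restricted_compositions k n r s)"
proof (rule finite_subset)
  have "length \<alpha> \<le> sum_list \<alpha>" if "\<forall>p\<in>set \<alpha>. 0 < p" for \<alpha> :: "nat list"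
    using that by (induction \<alpha>) auto
  then show "restricted_compositions k n r s
      \<subseteq> {\<alpha>. set \<alpha> \<subseteq> {..n + k - 1} \<and> length \<alpha> \<le> n + k - 1}"
    by (force simp: restricted_compositions_def is_composition_def dest: member_le_sum_list)
  show "finite {\<alpha>. set \<alpha> \<subseteq> {..n + k - 1} \<and> length \<alpha> \<le> n + k - 1}"
    by (rule finite_lists_length_le) simp
qed

lemma finite_index_pairs:
  fixes k n r s :: nat
  assumes "k \<ge> 1" "r > s"
  shows "finite {(i, j). int r * int i + int j * int (k + s) = int n - 1 - int s}"
proof (rule finite_subset)
  show "{(i, j). int r * int i + int j * int (k + s) = int n - 1 - int s} \<subseteq> {..n} \<times> {..n}"
  proof (rule subrelI)
    fix i j :: nat
    assume "(i, j) \<in> {(i, j). int r * int i + int j * int (k + s) = int n - 1 - int s}"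
    then have "int (r * i + j * (k + s) + 1 + s) = int n" by simp
    then have "r * i + j * (k + s) + 1 + s = n" by (simp only: of_nat_eq_iff)
    moreover have "i \<le> r * i" "j \<le> j * (k + s)"
      using assms by (cases r; simp)+
    ultimately have "i \<le> n" "j \<le> n" by linarith+
    then show "(i, j) \<in> {..n} \<times> {..n}" by simp
  qed
qed simp

end

theory Submission
  imports Defs
begin

text \<open>Since \<open>s < r\<close>, an admissible part is \<open>k + s + r * m\<close> for a unique \<open>m \<ge> 0\<close>. Hence the
  admissible compositions of length \<open>j + 1\<close> whose values \<open>m\<close> add up to \<open>i\<close> correspond to the
  sequences of \<open>j + 1\<close> natural numbers with sum \<open>i\<close>, of which there are \<open>i + j choose i\<close>, and they
  sum to \<open>n + k - 1\<close> exactly when \<open>r * i + j * (k + s) = n - 1 - s\<close>.\<close>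

text \<open>Writing \<open>p = k + q\<close> cancels \<open>k\<close> from the congruence; as
  \<open>s < r\<close>, the remainder of \<open>q\<close> is \<open>s\<close> itself, so
  \<open>m = q div r\<close>.\<close>

lemma ge_cong_iff:
  fixes k r s p :: nat
  assumes "s < r"
  shows "k \<le> p \<and> [p = k + s] (mod r) \<longleftrightarrow> (\<exists>m. p = k + s + r * m)"
proof
  assume "k \<le> p \<and> [p = k + s] (mod r)"
  then obtain q where p: "p = k + q" and "[k + q = k + s] (mod r)"
    using le_Suc_ex by blast
  then have "q mod r = s"
    using assms by (simp add: cong_add_lcancel_nat) (simp add: cong_def)
  then have "q = s + r * (q div r)"
    using mod_mult_div_eq[of q r] by simp
  then show "\<exists>m. p = k + s + r * m"
    using p by (metis add.assoc)
qed (auto simp: cong_def)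

lemma sum_list_map_affine:
  fixes a r :: nat
  shows "sum_list (map (\<lambda>m. a + r * m) ms) = r * sum_list ms + a * length ms"
  by (induction ms) (simp_all add: algebra_simps)

text \<open>Since \<open>k \<ge> 1\<close> makes parts positive, only a condition on each part and
  one on the sum remain; lists over the range of a map are the images of arbitrary lists.\<close>

lemma restricted_compositions_eq_image:
  assumes "k \<ge> 1" "r > s"
  shows "restricted_compositions k n r s =
    map (\<lambda>m. k + s + r * m) ` {ms. r * sum_list ms + (k + s) * length ms = n + k - 1}"
    (is "_ = map ?f ` ?B")
proof -
  have "\<alpha> \<in> restricted_compositions k n r s \<longleftrightarrow>
      \<alpha> \<in> lists (range ?f) \<and> sum_list \<alpha> = n + k - 1" for \<alpha>
    using assms(1) ge_cong_iff[OF assms(2), of k]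
    by (auto simp: restricted_compositions_def is_composition_def in_lists_conv_set image_iff)
  then show ?thesis
    by (auto simp: lists_image sum_list_map_affine[symmetric])
qed

text \<open>A single signed sum, unlike a difference of cardinalities, can be reindexed and
  grouped.\<close>

lemma b_diff_eq_signed_sum:
  "b_diff k n r s = (\<Sum>\<alpha>\<in>restricted_compositions k n r s. (- 1) ^ (length \<alpha> + 1))"
proof -
  let ?R = "restricted_compositions k n r s"
  have "(\<Sum>\<alpha>\<in>?R. (- 1 :: int) ^ (length \<alpha> + 1)) =
      (\<Sum>\<alpha>\<in>?R. of_bool (odd (length \<alpha>)) - of_bool (even (length \<alpha>)))"
    by (intro sum.cong) auto
  then show ?thesis
    using finite_restricted_compositions[of k n r s]
    by (simp add: b_diff_def c_odd_def c_even_def sum_subtractf of_bool_def sum.If_cases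
        Int_def)
qed

theorem theorem3p2:
  fixes k n r s :: nat
  assumes "k \<ge> 1" and "n \<ge> 1" and "r > s"
  shows "b_diff k n r s =
    (\<Sum>(i, j) \<in> {(i :: nat, j :: nat). int r * int i + int j * int (k + s) = int n - 1 - int s}.
        (- 1) ^ j * int ((i + j) choose i))"
proof -
  let ?P = "{(i :: nat, j :: nat). int r * int i + int j * int (k + s) = int n - 1 - int s}"
  let ?f = "\<lambda>m. k + s + r * m"
  \<comment> \<open>A list of length \<open>j + 1\<close> is indexed by \<open>j\<close>; truncation
    at \<open>[]\<close> is harmless, since \<open>n + k - 1 > 0\<close> keeps \<open>[]\<close> out
    of \<open>B\<close>.\<close>
  let ?idx = "\<lambda>ms :: nat list. (sum_list ms, length ms - 1)"
  define B where "B = {ms. r * sum_list ms + (k + s) * length ms = n + k - 1}"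
  have inj: "inj (map ?f)"
    using assms(3) by (auto intro: injI)
  have R: "restricted_compositions k n r s = map ?f ` B"
    unfolding B_def using assms by (intro restricted_compositions_eq_image)
  have finB: "finite B"
    using finite_restricted_compositions[of k n r s] inj R
    by (metis finite_imageD inj_on_subset subset_UNIV)
  \<comment> \<open>Adding \<open>k + s\<close> to both sides removes the possibly negative
    right-hand side and turns \<open>j\<close> into \<open>Suc j\<close>.\<close>
  have P_iff: "(i, j) \<in> ?P \<longleftrightarrow> r * i + (k + s) * Suc j = n + k - 1" for i j
  proof -
    have "r * i + (k + s) * Suc j = n + k - 1 \<longleftrightarrow>
        int (r * i + (k + s) * Suc j) = int (n + k - 1)"
      by (simp only: of_nat_eq_iff)
    also have "int (n + k - 1) = int n + int k - 1"
      using assms by simp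
    finally show ?thesis
      by (simp add: algebra_simps)
  qed
  have nonempty: "ms \<noteq> []" if "ms \<in> B" for ms
    using that assms by (auto simp: B_def)
  have idx: "?idx ` B \<subseteq> ?P"
  proof (rule image_subsetI)
    fix ms assume ms: "ms \<in> B"
    then have "Suc (length ms - 1) = length ms"
      using nonempty by simp
    then show "?idx ms \<in> ?P"
      unfolding P_iff using ms by (simp only: B_def mem_Collect_eq)
  qed
  \<comment> \<open>For a pair in \<open>?P\<close>, the prescribed length and sum already force
    membership in \<open>B\<close>.\<close>
  have fibre: "{ms \<in> B. ?idx ms = (i, j)} = {ms. length ms = Suc j \<and> sum_list ms = i}"
    if "(i, j) \<in> ?P" for i j
    using that nonempty unfolding P_iff by (fastforce simp: B_def)
  have "b_diff k n r s = (\<Sum>ms\<in>B. (- 1) ^ (length ms + 1))"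
    unfolding b_diff_eq_signed_sum R
    by (subst sum.reindex) (auto intro: inj_on_subset[OF inj])
  also have "\<dots> = (\<Sum>p\<in>?P. \<Sum>ms\<in>{ms \<in> B. ?idx ms = p}. (- 1) ^ (length ms + 1))"
    by (rule sum.group[symmetric, OF finB finite_index_pairs[OF assms(1,3)] idx])
  also have "\<dots> = (\<Sum>(i, j)\<in>?P. (- 1) ^ j * int ((i + j) choose i))"
  proof (rule sum.cong[OF refl], clarify)
    fix i j assume P: "int r * int i + int j * int (k + s) = int n - 1 - int s"
    then have "(\<Sum>ms\<in>{ms \<in> B. ?idx ms = (i, j)}. (- 1 :: int) ^ (length ms + 1)) =
        (\<Sum>ms\<in>{ms. length ms = Suc j \<and> sum_list ms = i}. (- 1) ^ j)"
      by (subst fibre) (auto intro!: sum.cong)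
    then show "(\<Sum>ms\<in>{ms \<in> B. ?idx ms = (i, j)}. (- 1 :: int) ^ (length ms + 1)) =
        (- 1) ^ j * int ((i + j) choose i)"
      \<comment> \<open>Stars and bars; the sign is constant on the fibre because
        \<open>(- 1) ^ (j + 2) = (- 1) ^ j\<close>.\<close>
      by (simp add: card_length_sum_list)
  qed
  finally show ?thesis .
qed

end
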